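(* Let $$c^* := \inf_{w} \limsup_{N \to \infty} \frac{N\, D_N^*(w)}{\log N},$$ where the infimum is taken over all sequences $w = (x_1, x_2, \ldots)$ in $[0,1)$. Then $c^* \ge 0.0646363$. Equivalently, for every sequence $x_1, x_2, \ldots$ in $[0,1)$ one has $N D_N^* \ge 0.0646363 \cdot \log N$ for infinitely many $N$.
   Context: For a sequence $w = (x_1, x_2, \ldots)$ in $[0,1)$ and $N \ge 1$, the star discrepancy of its first $N$ elements is $$D_N^*(w) = \sup_{x \in [0,1]} \left| \frac{\mathcal{A}_N(x)}{N} - x \right|, \qquad \mathcal{A}_N(x) := \#\{1 \le n \le N : x_n < x\}.$$ $\log$ denotes the natural logarithm. *)

theory Defs
  imports Complex_Main "HOL-Library.Liminf_Limsup" "HOL-Library.Extended_Real"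
begin

text \<open>
  Sequences \<open>x\<^sub>1, x\<^sub>2, \<dots>\<close> are functions on \<^typ>\<open>nat\<close> of which only the values at
  indices \<open>\<ge> 1\<close> matter; the value at \<open>0\<close> is never used.
\<close>

definition unit_seqs :: "(nat \<Rightarrow> real) set" where
  "unit_seqs = {w. \<forall>n\<ge>1. w n \<in> {0..<1}}"

definition count_below :: "(nat \<Rightarrow> real) \<Rightarrow> nat \<Rightarrow> real \<Rightarrow> nat" where
  "count_below w N x = card {n \<in> {1..N}. w n < x}"

definition star_discrepancy :: "(nat \<Rightarrow> real) \<Rightarrow> nat \<Rightarrow> real" where
  "star_discrepancy w N = (SUP x\<in>{0..1}. \<bar>real (count_below w N x) / real N - x\<bar>)"

text \<open>
  The limsup may be infinite for some sequences, hence it is taken in \<^typ>\<open>ereal\<close>.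
  The junk values of the quotient at \<open>N = 0\<close> and \<open>N = 1\<close> do not affect it.
\<close>

definition c_star :: ereal where
  "c_star = (INF w\<in>unit_seqs.
     limsup (\<lambda>N. ereal (real N * star_discrepancy w N / ln (real N))))"

end

theory Submission imports Defs "HOL-Analysis.Analysis" begin

text \<open>
  Put \<open>\<Delta>\<^sub>n(x) = A\<^sub>n(x) - n x\<close> and let \<open>G(N)\<close> be the integral over \<open>x\<close> of
  \<open>max\<^sub>n\<^sub>\<le>\<^sub>N \<Delta>\<^sub>n(x)\<close>. For the sequences \<open>w\<close> and \<open>1 - w\<close> it is at most the largest \<open>n D\<^sub>n\<^sup>*\<close>
  of \<open>w\<close>. Comparing the block \<open>{0..4T}\<close> with its first and last quarter through
  \<open>2 max(p,q) = p + q + |p - q|\<close> shows that \<open>2 G(4T)\<close> exceeds the sum of the values of \<open>G\<close> for the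
  two quarters by at least \<open>\<integral>|p - q| + \<integral>\<Delta>\<^sub>3\<^sub>T\<close>, where \<open>\<integral>\<Delta>\<^sub>3\<^sub>T\<close> changes sign when \<open>w\<close> is replaced by \<open>1 - w\<close>.
  Hence, if always \<open>\<integral>|p - q| \<ge> 23/128\<close>, then passing from \<open>T\<close> to \<open>4T\<close> adds at least \<open>23/128\<close> to
  the sum of \<open>G\<close> over \<open>w\<close> and \<open>1 - w\<close>, which gives the constant \<open>23/(256 ln 4) > 0.0648\<close>.

  Here \<open>f = q - p\<close> is the difference of the maxima of \<open>\<Delta>\<^sub>n(x)\<close> over the last and the first quarter,
  attained at \<open>n = n(x)\<close> and \<open>m = m(x)\<close>. As \<open>x\<close> grows, \<open>f\<close> decreases with slope \<open>n - m \<in> [2T, 4T]\<close> and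
  jumps up at the points of the sequence: by exactly \<open>1\<close> at the \<open>2T\<close> points of the two middle quarters,
  by some amount in \<open>[0,1]\<close> at the others. Being maximisers of families of lines, \<open>n\<close> and \<open>m\<close>
  can only decrease, except that \<open>n\<close> may increase at a point of the last quarter and \<open>m\<close> at a point
  of the first quarter. A potential \<open>W(f, n/T, m/T)\<close> turns this into the bound: along the descents it
  decreases at rate at most \<open>T (|f| - 1/4)\<close>, it drops by at most \<open>1/256\<close> at a point of the middle quarters and
  by at most \<open>1/32\<close> at the others. Since it takes the same value before the first and after the last
  point, we get \<open>\<integral>|f| \<ge> 1/4 - 2/256 - 2/32 = 23/128\<close>.
\<close>

section \<open>The potential\<close>

definition excess_square :: "real \<Rightarrow> real \<Rightarrow> real" where
  "excess_square c y = (max 0 (y - c))\<^sup>2 - (max 0 (- y - c))\<^sup>2"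

definition centred_abs_primitive :: "real \<Rightarrow> real" where
  "centred_abs_primitive y = excess_square 0 y / 2 - y / 4"

text \<open>
  The potential is \<open>W = P(y) + s Q(y) - (n + m)/256\<close>, where \<open>n\<close> and \<open>m\<close> are measured in units of \<open>T\<close>,
  \<open>s = n - m \<in> [2,4]\<close>, and \<open>P\<close>, \<open>Q\<close> are the base and slope potentials. Along a descent the requirement is
  \<open>s P'(y) + s\<^sup>2 Q'(y) \<le> |y| - 1/4\<close>. For \<open>|y| \<le> 1/4\<close> the choice
  \<open>P' = 3/4 (|y| - 1/4)\<close>, \<open>Q' = - (|y| - 1/4)/8\<close> gives equality at \<open>s = 2\<close> and \<open>s = 4\<close>; for
  \<open>1/4 \<le> |y| \<le> 1/2\<close> the same \<open>Q'\<close> allows \<open>P' = 11/16 (|y| - 1/4)\<close>, close to the optimal factor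
  \<open>1/\<surd>2\<close>. Up to \<open>|y| = 3/4\<close> the function \<open>Q\<close> continues with period \<open>1\<close>, so that a unit jump from near
  \<open>-1/2\<close> to near \<open>1/2\<close> does not change it; beyond that \<open>Q\<close> is constant and \<open>P' = 1/8\<close>.
\<close>

definition base_potential :: "real \<Rightarrow> real" where
  "base_potential y = 3/4 * centred_abs_primitive y - excess_square (1/4) y / 32
     - 7/16 * excess_square (1/2) y + 3/32 * excess_square (3/4) y"

definition slope_potential :: "real \<Rightarrow> real" where
  "slope_potential y = - centred_abs_primitive y / 8 + excess_square (1/2) y / 8
     - excess_square (3/4) y / 16"

definition descent_potential :: "real \<Rightarrow> real \<Rightarrow> real" where
  "descent_potential s y = base_potential y + s * slope_potential y"

definition descent_potential_deriv :: "real \<Rightarrow> real \<Rightarrow> real" where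
  "descent_potential_deriv s y = (3/4 - s/8) * (\<bar>y\<bar> - 1/4) - max 0 (\<bar>y\<bar> - 1/4) / 16
     + (s/4 - 7/8) * max 0 (\<bar>y\<bar> - 1/2) + (3/16 - s/8) * max 0 (\<bar>y\<bar> - 3/4)"

definition block_potential :: "real \<Rightarrow> real \<Rightarrow> real \<Rightarrow> real" where
  "block_potential y n m = descent_potential (n - m) y - (n + m) / 256"

lemmas potential_defs = descent_potential_def base_potential_def slope_potential_def
  centred_abs_primitive_def excess_square_def

lemma DERIV_pos_part_square:
  "((\<lambda>x::real. (max 0 x)\<^sup>2) has_real_derivative 2 * max 0 x) (at x)"
  unfolding DERIV_def
proof (rule LIM_zero_cancel, rule Lim_null_comparison)
  have remainder: "\<bar>(max 0 (x + h))\<^sup>2 - (max 0 x)\<^sup>2 - 2 * max 0 x * h\<bar> \<le> h\<^sup>2" for h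
  proof (cases "0 \<le> x \<longleftrightarrow> 0 \<le> x + h")
    case False
    then have "\<bar>x + h\<bar> \<le> \<bar>h\<bar>" by linarith
    then have "(x + h)\<^sup>2 \<le> h\<^sup>2" by (simp add: abs_le_square_iff)
    with False zero_le_power2[of "x + h"] show ?thesis
      by (auto simp: max_def power2_sum)
  qed (auto simp: max_def power2_sum)
  have "norm (((max 0 (x + h))\<^sup>2 - (max 0 x)\<^sup>2) / h - 2 * max 0 x) \<le> \<bar>h\<bar>" if "h \<noteq> 0" for h
  proof -
    have "((max 0 (x + h))\<^sup>2 - (max 0 x)\<^sup>2) / h - 2 * max 0 x
        = ((max 0 (x + h))\<^sup>2 - (max 0 x)\<^sup>2 - 2 * max 0 x * h) / h"
      using that by (simp add: diff_divide_distrib)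
    then show ?thesis
      using remainder[of h] that by (simp add: pos_divide_le_eq power2_eq_square)
  qed
  then show "\<forall>\<^sub>F h in at 0. norm (((max 0 (x + h))\<^sup>2 - (max 0 x)\<^sup>2) / h - 2 * max 0 x) \<le> \<bar>h\<bar>"
    by (simp add: eventually_at_filter)
qed (auto intro!: tendsto_eq_intros)

lemma DERIV_excess_square:
  assumes "c \<ge> 0"
  shows "(excess_square c has_real_derivative 2 * max 0 (\<bar>y\<bar> - c)) (at y)"
proof -
  have "((\<lambda>y. (max 0 (y - c))\<^sup>2) has_real_derivative 2 * max 0 (y - c) * 1) (at y)"
    by (rule DERIV_chain'[OF _ DERIV_pos_part_square]) (auto intro!: derivative_eq_intros)
  moreover have "((\<lambda>y. (max 0 (- y - c))\<^sup>2) has_real_derivative 2 * max 0 (- y - c) * - 1) (at y)"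
    by (rule DERIV_chain'[OF _ DERIV_pos_part_square]) (auto intro!: derivative_eq_intros)
  ultimately have "(excess_square c has_real_derivative
      2 * max 0 (y - c) * 1 - 2 * max 0 (- y - c) * - 1) (at y)"
    unfolding excess_square_def[abs_def] by (rule DERIV_diff)
  also have "2 * max 0 (y - c) * 1 - 2 * max 0 (- y - c) * - 1 = 2 * max 0 (\<bar>y\<bar> - c)"
    using assms by (auto simp: max_def)
  finally show ?thesis .
qed

lemma DERIV_centred_abs_primitive:
  "(centred_abs_primitive has_real_derivative \<bar>y\<bar> - 1/4) (at y)"
  unfolding centred_abs_primitive_def[abs_def]
  by (auto intro!: derivative_eq_intros DERIV_excess_square)

lemma DERIV_descent_potential:
  "(descent_potential s has_real_derivative descent_potential_deriv s y) (at y)"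
  unfolding descent_potential_def[abs_def] base_potential_def slope_potential_def
    descent_potential_deriv_def
  by (rule derivative_eq_intros DERIV_excess_square DERIV_centred_abs_primitive refl
      | simp add: field_simps)+

lemma excess_square_minus: "excess_square c (- y) = - excess_square c y"
  by (simp add: excess_square_def)

lemma slope_potential_minus: "slope_potential (- y) = - slope_potential y"
  by (simp add: slope_potential_def centred_abs_primitive_def excess_square_minus field_simps)

lemma descent_potential_minus: "descent_potential s (- y) = - descent_potential s y"
  by (simp add: descent_potential_def base_potential_def slope_potential_minus
      centred_abs_primitive_def excess_square_minus field_simps)

lemma descent_potential_deriv_le:
  assumes s: "2 \<le> s" "s \<le> 4"
  shows "s * descent_potential_deriv s y \<le> \<bar>y\<bar> - 1/4"
proof -
  let ?r = "\<bar>y\<bar>" and ?slack = "\<bar>y\<bar> - 1/4 - s * descent_potential_deriv s y"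
  have quadratic: "0 \<le> 1 - 11/16 * s + s * s / 8"
    using zero_le_square[of "s - 11/4"] by (simp add: algebra_simps)
  consider "?r \<le> 1/4" | "1/4 \<le> ?r" "?r \<le> 1/2" | "1/2 \<le> ?r" "?r \<le> 3/4" | "3/4 \<le> ?r"
    by linarith
  then have "0 \<le> ?slack"
  proof cases
    case 1
    have "0 \<le> (1/4 - ?r) * ((s - 2) * (4 - s)) / 8"
      using 1 s by (intro divide_nonneg_nonneg mult_nonneg_nonneg) auto
    also have "\<dots> = ?slack"
      using 1 by (simp add: descent_potential_deriv_def max_def field_simps)
    finally show ?thesis .
  next
    case 2
    have "0 \<le> (?r - 1/4) * (1 - 11/16 * s + s * s / 8)"
      using 2 quadratic by (intro mult_nonneg_nonneg) auto
    also have "\<dots> = ?slack"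
      using 2 by (auto simp: descent_potential_deriv_def max_def field_simps)
    finally show ?thesis .
  next
    case 3
    have "0 \<le> (3/4 - ?r) * (1 - 11/16 * s + s * s / 8) + (?r - 1/2) * (2 - s/2)"
      using 3 quadratic s
      by (intro add_nonneg_nonneg[OF mult_nonneg_nonneg mult_nonneg_nonneg]) auto
    also have "\<dots> = ?slack"
      using 3 by (auto simp: descent_potential_deriv_def max_def field_simps)
    finally show ?thesis .
  next
    case 4
    have "0 \<le> (?r - 3/4) + (4 - s) / 8"
      using 4 s by auto
    also have "\<dots> = ?slack"
      using 4 by (auto simp: descent_potential_deriv_def max_def field_simps)
    finally show ?thesis .
  qed
  then show ?thesis by simp
qed

lemma descent_potential_deriv_nonneg:
  assumes s: "2 \<le> s" "s \<le> 4" and y: "1/2 \<le> y"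
  shows "0 \<le> descent_potential_deriv s y"
proof (cases "y \<le> 3/4")
  case True
  have "0 \<le> (y - 1/2) / 2 + (3/4 - y) * (11/16 - s/8)"
    using True y s by (intro add_nonneg_nonneg mult_nonneg_nonneg) auto
  also have "\<dots> = descent_potential_deriv s y"
    using True y by (auto simp: descent_potential_deriv_def max_def field_simps)
  finally show ?thesis .
next
  case False
  then have "descent_potential_deriv s y = 1/8"
    by (auto simp: descent_potential_deriv_def max_def field_simps)
  then show ?thesis by simp
qed

lemma descent_potential_diff_le:
  assumes s: "2 \<le> s" "s \<le> 4" and "u \<le> v"
  shows "s * (descent_potential s v - descent_potential s u)
    \<le> centred_abs_primitive v - centred_abs_primitive u"
proof -
  let ?f = "\<lambda>y. centred_abs_primitive y - s * descent_potential s y"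
  have "(?f has_real_derivative (\<bar>y\<bar> - 1/4) - s * descent_potential_deriv s y) (at y)" for y
    by (intro DERIV_diff DERIV_cmult DERIV_centred_abs_primitive DERIV_descent_potential)
  then have "?f u \<le> ?f v"
    by (intro DERIV_nonneg_imp_nondecreasing[OF \<open>u \<le> v\<close>])
       (meson descent_potential_deriv_le[OF s] diff_ge_0_iff_ge)
  then show ?thesis
    by (simp add: algebra_simps)
qed

lemma descent_potential_mono_outer:
  assumes s: "2 \<le> s" "s \<le> 4" and uv: "1/2 \<le> u" "u \<le> v"
  shows "descent_potential s u \<le> descent_potential s v"
  using DERIV_descent_potential descent_potential_deriv_nonneg[OF s] uv
  by (intro DERIV_nonneg_imp_nondecreasing[OF \<open>u \<le> v\<close>]) (meson order_trans)

lemma abs_slope_potential_le: "\<bar>slope_potential y\<bar> \<le> 1/256"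
proof -
  have nonneg: "\<bar>slope_potential y\<bar> \<le> 1/256" if "0 \<le> y" for y
  proof -
    consider "y \<le> 1/2" | "1/2 \<le> y" "y \<le> 3/4" | "3/4 \<le> y" by linarith
    then show ?thesis
    proof cases
      case 1
      have "slope_potential y = 1/256 - (y - 1/4)\<^sup>2 / 16"
        using 1 that by (auto simp: potential_defs max_def power2_eq_square field_simps)
      moreover have "(y - 1/4)\<^sup>2 \<le> (1/4)\<^sup>2"
        using 1 that by (intro power2_le_iff_abs_le[THEN iffD2]) linarith+
      ultimately show ?thesis
        using zero_le_power2[of "y - 1/4"] by (simp add: power2_eq_square)
    next
      case 2
      have "slope_potential y = (y - 3/4)\<^sup>2 / 16 - 1/256"
        using 2 by (auto simp: potential_defs max_def power2_eq_square field_simps)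
      moreover have "(y - 3/4)\<^sup>2 \<le> (1/4)\<^sup>2"
        using 2 by (intro power2_le_iff_abs_le[THEN iffD2]) auto
      ultimately show ?thesis
        using zero_le_power2[of "y - 3/4"] by (simp add: power2_eq_square)
    next
      case 3
      then show ?thesis
        by (auto simp: potential_defs max_def power2_eq_square field_simps)
    qed
  qed
  show ?thesis
    using nonneg[of y] nonneg[of "- y"] by (cases "0 \<le> y") (auto simp: slope_potential_minus)
qed

lemma descent_potential_inner_bounds:
  assumes s: "2 \<le> s" "s \<le> 4" and y: "0 \<le> y" "y \<le> 1/2"
  shows "- (6 - s) / 256 \<le> descent_potential s y" and "descent_potential s y \<le> 0"
proof -
  let ?z = "(y - 1/4)\<^sup>2" and ?m = "(max 0 (y - 1/4))\<^sup>2"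
  have eq: "descent_potential s y = (3/4 - s/8) * (?z / 2 - 1/32) - ?m / 32"
    using y by (auto simp: potential_defs max_def power2_eq_square field_simps)
  have m: "0 \<le> ?m" "?m \<le> ?z"
    by (auto simp: max_def)
  have z: "?z \<le> (1/4)\<^sup>2"
    using y by (intro power2_le_iff_abs_le[THEN iffD2]) linarith+
  have "0 \<le> (1/4 - s/16) * ?z"
    using s by auto
  then have "?z / 8 - (6 - s) / 256 \<le> (3/4 - s/8) * (?z / 2 - 1/32)"
    by (simp add: algebra_simps diff_divide_distrib)
  then show "- (6 - s) / 256 \<le> descent_potential s y"
    unfolding eq using m by linarith
  have "(3/4 - s/8) * (?z / 2 - 1/32) \<le> 0"
    using s z by (intro mult_nonneg_nonpos) (auto simp: power2_eq_square)
  then show "descent_potential s y \<le> 0"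
    unfolding eq using m by linarith
qed

lemma descent_potential_upper_bound:
  assumes s: "2 \<le> s" "s \<le> 4" and y: "y \<le> 1/2"
  shows "descent_potential s y \<le> (6 - s) / 256"
proof -
  consider "0 \<le> y" | "- 1/2 \<le> y" "y \<le> 0" | "y \<le> - 1/2" by linarith
  then show ?thesis
  proof cases
    case 1
    then show ?thesis using descent_potential_inner_bounds(2)[OF s 1 y] s by simp
  next
    case 2
    then show ?thesis
      using descent_potential_inner_bounds(1)[OF s, of "- y"] by (simp add: descent_potential_minus)
  next
    case 3
    have "descent_potential s (1/2) \<le> - descent_potential s y"
      using descent_potential_mono_outer[OF s, of "1/2" "- y"] 3
      by (simp add: descent_potential_minus)
    then show ?thesis using descent_potential_inner_bounds(1)[OF s, of "1/2"] by simp
  qed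
qed

lemma descent_potential_unit_jump:
  assumes s: "2 \<le> s" "s \<le> 4"
  shows "descent_potential s y \<le> 1/256 + descent_potential s (y + 1)"
proof -
  have upper: "descent_potential s y \<le> 1/256 + descent_potential s (y + 1)" if "- 1/2 \<le> y" for y
  proof -
    consider "y \<le> - 1/4" | "- 1/4 \<le> y" "y \<le> 1/2" | "1/2 \<le> y" by linarith
    then show ?thesis
    proof cases
      case 1
      have "descent_potential s (y + 1) - descent_potential s y = (y + 1/2)\<^sup>2 / 4 - 1/256"
        using 1 that by (auto simp: potential_defs max_def power2_eq_square field_simps)
      then show ?thesis using zero_le_power2[of "y + 1/2"] by linarith
    next
      case 2
      have "descent_potential s (3/4) = 9/256 - s/256"
        by (auto simp: potential_defs max_def power2_eq_square field_simps)
      then show ?thesis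
        using descent_potential_mono_outer[OF s, of "3/4" "y + 1"]
          descent_potential_upper_bound[OF s, of y] 2 by simp
    next
      case 3
      then show ?thesis using descent_potential_mono_outer[OF s, of y "y + 1"] by simp
    qed
  qed
  show ?thesis
  proof (cases "- 1/2 \<le> y")
    case False
    then have "descent_potential s (- (y + 1)) \<le> 1/256 + descent_potential s (- y)"
      using upper[of "- (y + 1)"] by simp
    then show ?thesis unfolding descent_potential_minus by simp
  qed (rule upper)
qed

lemma descent_potential_partial_jump:
  assumes s: "2 \<le> s" "s \<le> 4" and s': "2 \<le> s'" "s' \<le> 4"
    and ss': "5 \<le> s + s'" "\<bar>s - s'\<bar> \<le> 1" and yz: "y \<le> z"
  shows "descent_potential s y \<le> 7/256 + descent_potential s' z"
proof -
  have "\<bar>(s - s') * slope_potential z\<bar> \<le> 1 * (1/256)"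
    unfolding abs_mult using ss' abs_slope_potential_le[of z] by (intro mult_mono) auto
  then have "(s - s') * slope_potential z \<le> 7/256" by linarith
  then have "descent_potential s z \<le> 7/256 + descent_potential s' z"
    by (simp add: descent_potential_def left_diff_distrib)
  then have outer: "descent_potential s y \<le> 7/256 + descent_potential s' z"
    if "descent_potential s y \<le> descent_potential s z"
    using that by simp
  consider "1/2 \<le> y" | "z \<le> - 1/2" | "y \<le> 1/2" "- 1/2 \<le> z" by linarith
  then show ?thesis
  proof cases
    case 1
    then show ?thesis using outer descent_potential_mono_outer[OF s, of y z] yz by simp
  next
    case 2
    then show ?thesis
      using outer descent_potential_mono_outer[OF s, of "- z" "- y"] yz
      by (simp add: descent_potential_minus)
  next
    case 3
    have "descent_potential s y \<le> (6 - s) / 256" "- descent_potential s' z \<le> (6 - s') / 256"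
      using 3 descent_potential_upper_bound[OF s, of y]
        descent_potential_upper_bound[OF s', of "- z"]
      by (auto simp: descent_potential_minus)
    then show ?thesis using ss' by simp
  qed
qed

lemma block_potential_antimono:
  assumes "n' \<le> n" "m' \<le> m"
  shows "block_potential y n m \<le> block_potential y n' m'"
proof -
  have "(n - n') * (slope_potential y - 1/256) \<le> 0"
    using assms abs_slope_potential_le[of y] by (intro mult_nonneg_nonpos) auto
  moreover have "(m - m') * (- slope_potential y - 1/256) \<le> 0"
    using assms abs_slope_potential_le[of y] by (intro mult_nonneg_nonpos) auto
  ultimately show ?thesis
    by (simp add: block_potential_def descent_potential_def field_simps)
qed

lemma block_potential_unit_jump:
  assumes "3 \<le> n" "n \<le> 4" "0 \<le> m" "m \<le> 1"
  shows "block_potential y n m \<le> 1/256 + block_potential (y + 1) n m"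
  using descent_potential_unit_jump[of "n - m" y] assms by (simp add: block_potential_def)

lemma block_potential_jump_last:
  assumes "3 \<le> n" "n' \<le> 4" "0 \<le> m" "m \<le> 1" "y \<le> z"
  shows "block_potential y n m \<le> 1/32 + block_potential z n' m"
proof -
  have "block_potential y n m \<le> block_potential y 3 m"
    using assms by (intro block_potential_antimono) auto
  also have "\<dots> \<le> 1/32 + block_potential z 4 m"
    using descent_potential_partial_jump[of "3 - m" "4 - m" y z] assms
    by (simp add: block_potential_def add_divide_distrib)
  also have "block_potential z 4 m \<le> block_potential z n' m"
    using assms by (intro block_potential_antimono) auto
  finally show ?thesis by simp
qed

lemma block_potential_jump_first:
  assumes "3 \<le> n" "n \<le> 4" "0 \<le> m" "m' \<le> 1" "y \<le> z"
  shows "block_potential y n m \<le> 1/32 + block_potential z n m'"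
proof -
  have "block_potential y n m \<le> block_potential y n 0"
    using assms by (intro block_potential_antimono) auto
  also have "\<dots> \<le> 1/32 + block_potential z n 1"
    using descent_potential_partial_jump[of n "n - 1" y z] assms
    by (simp add: block_potential_def add_divide_distrib)
  also have "block_potential z n 1 \<le> block_potential z n m'"
    using assms by (intro block_potential_antimono) auto
  finally show ?thesis by simp
qed

section \<open>Maximisers of finite families\<close>

definition argmaxs :: "'a set \<Rightarrow> ('a \<Rightarrow> 'b::linorder) \<Rightarrow> 'a set" where
  "argmaxs I h = {n \<in> I. \<forall>k\<in>I. h k \<le> h n}"

definition first_argmax :: "'a::linorder set \<Rightarrow> ('a \<Rightarrow> 'b::linorder) \<Rightarrow> 'a" where
  "first_argmax I h = Min (argmaxs I h)"

definition last_argmax :: "'a::linorder set \<Rightarrow> ('a \<Rightarrow> 'b::linorder) \<Rightarrow> 'a" where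
  "last_argmax I h = Max (argmaxs I h)"

lemma Max_image_eq_argmax:
  assumes "finite I" "n \<in> argmaxs I h"
  shows "Max (h ` I) = h n"
  using assms by (intro Max_eqI) (auto simp: argmaxs_def)

lemma argmaxs_nonempty:
  assumes "finite I" "I \<noteq> {}"
  shows "argmaxs I h \<noteq> {}"
proof -
  have "Max (h ` I) \<in> h ` I" using assms by simp
  then obtain n where "n \<in> I" "h n = Max (h ` I)" by auto
  then have "n \<in> argmaxs I h" using assms by (simp add: argmaxs_def)
  then show ?thesis by blast
qed

lemma finite_argmaxs: "finite I \<Longrightarrow> finite (argmaxs I h)"
  by (simp add: argmaxs_def)

lemma first_argmax_in_argmaxs: "finite I \<Longrightarrow> I \<noteq> {} \<Longrightarrow> first_argmax I h \<in> argmaxs I h"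
  unfolding first_argmax_def by (intro Min_in finite_argmaxs argmaxs_nonempty)

lemma last_argmax_in_argmaxs: "finite I \<Longrightarrow> I \<noteq> {} \<Longrightarrow> last_argmax I h \<in> argmaxs I h"
  unfolding last_argmax_def by (intro Max_in finite_argmaxs argmaxs_nonempty)

lemma first_argmax_in: "finite I \<Longrightarrow> I \<noteq> {} \<Longrightarrow> first_argmax I h \<in> I"
  using first_argmax_in_argmaxs[of I h] by (simp add: argmaxs_def)

lemma last_argmax_in: "finite I \<Longrightarrow> I \<noteq> {} \<Longrightarrow> last_argmax I h \<in> I"
  using last_argmax_in_argmaxs[of I h] by (simp add: argmaxs_def)

lemma first_argmax_le_last_argmax:
  "finite I \<Longrightarrow> I \<noteq> {} \<Longrightarrow> first_argmax I h \<le> last_argmax I h"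
  using last_argmax_in_argmaxs[of I h] by (simp add: first_argmax_def finite_argmaxs)

lemma last_argmax_singleton: "argmaxs I h = {n} \<Longrightarrow> last_argmax I h = n"
  by (simp add: last_argmax_def)

lemma argmaxs_cong: "(\<And>n. n \<in> I \<Longrightarrow> g n = h n) \<Longrightarrow> argmaxs I g = argmaxs I h"
  by (auto simp: argmaxs_def)

lemma last_argmax_shift:
  fixes g h :: "'a::linorder \<Rightarrow> 'b::linordered_ab_group_add"
  assumes "\<And>n. n \<in> I \<Longrightarrow> g n = h n + c"
  shows "last_argmax I g = last_argmax I h"
proof -
  have "argmaxs I g = argmaxs I h" using assms by (auto simp: argmaxs_def)
  then show ?thesis by (simp add: last_argmax_def)
qed

lemma Max_image_shift:
  fixes g h :: "'a \<Rightarrow> 'b::linordered_ab_group_add"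
  assumes "finite I" "I \<noteq> {}" "\<And>n. n \<in> I \<Longrightarrow> g n = h n + c"
  shows "Max (g ` I) = Max (h ` I) + c"
  using Max_add_commute[OF assms(1,2), of h c] assms(3) by (simp cong: image_cong)

lemma eventually_affine_less:
  fixes a b c d :: real
  assumes "a < b \<or> a = b \<and> c < d"
  shows "\<forall>\<^sub>F t in at_right 0. a + c * t < b + d * t"
proof (cases "a < b")
  case True
  have "((\<lambda>t. b + d * t - (a + c * t)) \<longlongrightarrow> b - a) (at_right 0)"
    by (auto intro!: tendsto_eq_intros)
  then have "\<forall>\<^sub>F t in at_right 0. 0 < b + d * t - (a + c * t)"
    by (rule order_tendstoD(1)) (use True in simp)
  then show ?thesis by eventually_elim simp
next
  case False
  then show ?thesis
    using assms eventually_at_right_less[of "0::real"] by (auto elim: eventually_mono)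
qed

lemma eventually_argmaxs_affine:
  fixes h c :: "'a \<Rightarrow> real"
  assumes "finite I" and N: "N \<in> argmaxs I h"
    and steepest: "\<And>n. n \<in> argmaxs I h \<Longrightarrow> n \<noteq> N \<Longrightarrow> c n < c N"
  shows "\<forall>\<^sub>F t in at_right 0. argmaxs I (\<lambda>n. h n + c n * t) = {N}"
proof -
  have "h n < h N \<or> h n = h N \<and> c n < c N" if "n \<in> I - {N}" for n
  proof -
    have "h n \<le> h N" using N that by (auto simp: argmaxs_def)
    moreover have "n \<in> argmaxs I h" if "h n = h N"
      using N that \<open>n \<in> I - {N}\<close> by (auto simp: argmaxs_def)
    ultimately show ?thesis using steepest[of n] that by force
  qed
  then have "\<forall>\<^sub>F t in at_right 0. \<forall>n\<in>I - {N}. h n + c n * t < h N + c N * t"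
    using \<open>finite I\<close> by (intro eventually_ball_finite ballI eventually_affine_less) auto
  then show ?thesis
  proof eventually_elim
    case (elim t)
    have "N \<in> I" using N by (simp add: argmaxs_def)
    moreover have "h n + c n * t \<le> h N + c N * t" if "n \<in> I" for n
      using elim that by (cases "n = N") (auto intro: less_imp_le)
    moreover have "n = N" if "n \<in> I" "h N + c N * t \<le> h n + c n * t" for n
      using bspec[OF elim, of n] that by (auto simp: not_le[symmetric])
    ultimately show ?case
      unfolding argmaxs_def by blast
  qed
qed

lemma eventually_argmaxs_increasing_slope:
  fixes h c :: "'a::linorder \<Rightarrow> real"
  assumes I: "finite I" "I \<noteq> {}" and c: "\<And>i j. i < j \<Longrightarrow> c i < c j"
  shows "\<forall>\<^sub>F t in at_right 0. argmaxs I (\<lambda>n. h n + c n * t) = {last_argmax I h}"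
proof (rule eventually_argmaxs_affine)
  fix n assume n: "n \<in> argmaxs I h" "n \<noteq> last_argmax I h"
  have "n \<le> last_argmax I h"
    unfolding last_argmax_def using n(1) I by (intro Max_ge finite_argmaxs)
  with n(2) show "c n < c (last_argmax I h)" by (intro c) simp
qed (use I in \<open>auto intro: last_argmax_in_argmaxs\<close>)

lemma eventually_argmaxs_decreasing_slope:
  fixes h c :: "'a::linorder \<Rightarrow> real"
  assumes I: "finite I" "I \<noteq> {}" and c: "\<And>i j. i < j \<Longrightarrow> c j < c i"
  shows "\<forall>\<^sub>F t in at_right 0. argmaxs I (\<lambda>n. h n + c n * t) = {first_argmax I h}"
proof (rule eventually_argmaxs_affine)
  fix n assume n: "n \<in> argmaxs I h" "n \<noteq> first_argmax I h"
  have "first_argmax I h \<le> n"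
    unfolding first_argmax_def using n(1) I by (intro Min_le finite_argmaxs)
  with n(2) show "c n < c (first_argmax I h)" by (intro c) simp
qed (use I in \<open>auto intro: first_argmax_in_argmaxs\<close>)

lemma Max_image_mono:
  fixes g h :: "'a \<Rightarrow> 'b::linorder"
  assumes "finite I" "I \<noteq> {}" "\<And>n. n \<in> I \<Longrightarrow> g n \<le> h n"
  shows "Max (g ` I) \<le> Max (h ` I)"
proof (intro Max.boundedI)
  fix y assume "y \<in> g ` I"
  then obtain n where "n \<in> I" "y = g n" by blast
  then have "y \<le> h n" using assms(3) by simp
  also have "h n \<le> Max (h ` I)" using \<open>n \<in> I\<close> assms(1) by simp
  finally show "y \<le> Max (h ` I)" .
qed (use assms in auto)

lemma absolutely_integrable_Max:
  fixes f :: "'a \<Rightarrow> 'n::euclidean_space \<Rightarrow> real"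
  assumes "finite I" "I \<noteq> {}" "\<And>i. i \<in> I \<Longrightarrow> f i absolutely_integrable_on S"
  shows "(\<lambda>x. Max ((\<lambda>i. f i x) ` I)) absolutely_integrable_on S"
  using assms by (induction rule: finite_ne_induct) (auto intro!: absolutely_integrable_max_1)

section \<open>Local discrepancies\<close>

definition local_discrepancy :: "(nat \<Rightarrow> real) \<Rightarrow> nat \<Rightarrow> real \<Rightarrow> real" where
  "local_discrepancy w n x = real (count_below w n x) - real n * x"

definition local_discrepancy_right :: "(nat \<Rightarrow> real) \<Rightarrow> nat \<Rightarrow> real \<Rightarrow> real" where
  "local_discrepancy_right w n x = real (card {k \<in> {1..n}. w k \<le> x}) - real n * x"

lemma local_discrepancy_0 [simp]: "local_discrepancy w 0 x = 0"
  by (simp add: local_discrepancy_def count_below_def)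

lemma local_discrepancy_eq_sum:
  "local_discrepancy w n x = (\<Sum>k=1..n. of_bool (w k < x) - x)"
  by (simp add: local_discrepancy_def count_below_def sum_subtractf sum_of_bool_eq Int_def)

lemma local_discrepancy_right_eq_sum:
  "local_discrepancy_right w n x = (\<Sum>k=1..n. of_bool (w k \<le> x) - x)"
  by (simp add: local_discrepancy_right_def sum_subtractf sum_of_bool_eq Int_def)

lemma local_discrepancy_right_eq:
  "local_discrepancy_right w n x = local_discrepancy w n x + real (card {k \<in> {1..n}. w k = x})"
proof -
  have "(\<Sum>k=1..n. of_bool (w k \<le> x) - x) = (\<Sum>k=1..n. (of_bool (w k < x) - x) + of_bool (w k = x))"
    by (intro sum.cong) auto
  then show ?thesis
    by (simp add: local_discrepancy_right_eq_sum local_discrepancy_eq_sum sum.distrib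
        sum_of_bool_eq Int_def)
qed

lemma local_discrepancy_add:
  "local_discrepancy w (K + n) x
     = local_discrepancy w K x + local_discrepancy (\<lambda>k. w (K + k)) n x"
proof -
  have "(\<Sum>k=K+1..K+n. of_bool (w k < x) - x) = (\<Sum>k=1..n. of_bool (w (K + k) < x) - x)"
    by (rule sum.reindex_bij_witness[of _ "\<lambda>k. K + k" "\<lambda>k. k - K"]) auto
  then show ?thesis
    unfolding local_discrepancy_eq_sum by (subst sum.ub_add_nat) auto
qed

lemma local_discrepancy_reflect_le:
  "local_discrepancy (\<lambda>k. 1 - w k) n x \<le> - local_discrepancy w n (1 - x)"
  unfolding local_discrepancy_eq_sum by (simp flip: sum_negf) (intro sum_mono, auto)

lemma eventually_less_diff_iff:
  fixes c x :: real
  shows "\<forall>\<^sub>F t in at_right 0. c < x - t \<longleftrightarrow> c < x"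
proof (cases "c < x")
  case True
  then have "\<forall>\<^sub>F t in at_right 0. t < x - c"
    by (intro order_tendstoD(2)[OF tendsto_ident_at]) auto
  then show ?thesis by eventually_elim (use True in auto)
next
  case False
  then show ?thesis
    using eventually_at_right_less[of "0::real"] by (auto elim: eventually_mono)
qed

lemma eventually_less_add_iff:
  fixes c x :: real
  shows "\<forall>\<^sub>F t in at_right 0. c < x + t \<longleftrightarrow> c \<le> x"
proof (cases "c \<le> x")
  case True
  then show ?thesis
    using eventually_at_right_less[of "0::real"] by (auto elim: eventually_mono)
next
  case False
  then have "\<forall>\<^sub>F t in at_right 0. t < c - x"
    by (intro order_tendstoD(2)[OF tendsto_ident_at]) auto
  then show ?thesis by eventually_elim (use False in auto)
qed

lemma eventually_local_discrepancy_left: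
  "\<forall>\<^sub>F t in at_right 0. \<forall>n\<le>N. local_discrepancy w n (x - t) = local_discrepancy w n x + real n * t"
proof -
  have "\<forall>\<^sub>F t in at_right 0. \<forall>k\<in>{1..N}. w k < x - t \<longleftrightarrow> w k < x"
    by (intro eventually_ball_finite ballI eventually_less_diff_iff) simp
  then show ?thesis
  proof eventually_elim
    case (elim t)
    have "(\<Sum>k=1..n. of_bool (w k < x - t) - (x - t)) = (\<Sum>k=1..n. (of_bool (w k < x) - x) + t)"
      if "n \<le> N" for n
      using elim that by (intro sum.cong) auto
    then show ?case
      by (simp add: local_discrepancy_eq_sum sum.distrib del: sum_of_bool_eq)
  qed
qed

lemma eventually_local_discrepancy_right:
  "\<forall>\<^sub>F t in at_right 0. \<forall>n\<le>N.
     local_discrepancy w n (x + t) = local_discrepancy_right w n x - real n * t"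
proof -
  have "\<forall>\<^sub>F t in at_right 0. \<forall>k\<in>{1..N}. w k < x + t \<longleftrightarrow> w k \<le> x"
    by (intro eventually_ball_finite ballI eventually_less_add_iff) simp
  then show ?thesis
  proof eventually_elim
    case (elim t)
    have "(\<Sum>k=1..n. of_bool (w k < x + t) - (x + t)) = (\<Sum>k=1..n. (of_bool (w k \<le> x) - x) - t)"
      if "n \<le> N" for n
      using elim that by (intro sum.cong) auto
    then show ?case
      by (simp add: local_discrepancy_eq_sum local_discrepancy_right_eq_sum sum_subtractf
          del: sum_of_bool_eq)
  qed
qed

lemma has_integral_of_bool_less:
  fixes a b c :: real
  assumes "c \<in> {a..b}"
  shows "((\<lambda>x. of_bool (c < x) :: real) has_integral (b - c)) {a..b}"
proof -
  have "((\<lambda>x. 1) has_integral (b - c)) {c..b}"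
    using has_integral_const_real[of "1::real" c b] assms by simp
  then have "((\<lambda>x. if x \<in> {c..b} then 1 else 0) has_integral (b - c)) {a..b}"
    using assms by (subst has_integral_restrict) auto
  then show ?thesis
    by (rule has_integral_spike_finite[of "{c}", rotated 2]) auto
qed

lemma absolutely_integrable_local_discrepancy:
  assumes "\<And>k. k \<in> {1..n} \<Longrightarrow> w k \<in> {0..1}"
  shows "local_discrepancy w n absolutely_integrable_on {0..1}"
proof -
  have "(\<lambda>x. of_bool (w k < x) - x) absolutely_integrable_on {0..1}" if "k \<in> {1..n}" for k
    using has_integral_of_bool_less[OF assms[OF that]]
    by (intro set_integral_diff nonnegative_absolutely_integrable_1
        absolutely_integrable_continuous_real) (auto intro!: continuous_intros)
  then show ?thesis
    unfolding local_discrepancy_eq_sum[abs_def] by (intro absolutely_integrable_sum) auto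
qed

lemma local_discrepancy_has_integral:
  assumes "\<And>k. k \<in> {1..n} \<Longrightarrow> w k \<in> {0..1}"
  shows "(local_discrepancy w n has_integral (\<Sum>k=1..n. 1/2 - w k)) {0..1}"
  unfolding local_discrepancy_eq_sum[abs_def]
proof (rule has_integral_sum)
  show "((\<lambda>x. of_bool (w k < x) - x) has_integral (1/2 - w k)) {0..1}" if "k \<in> {1..n}" for k
    using has_integral_diff[OF has_integral_of_bool_less[OF assms[OF that]]
        ident_has_integral[of 0 1]] by simp
qed simp

lemma abs_local_discrepancy_le:
  assumes "x \<in> {0..1}"
  shows "\<bar>local_discrepancy w n x\<bar> \<le> real n"
proof -
  have "\<bar>local_discrepancy w n x\<bar> \<le> (\<Sum>k=1..n. \<bar>of_bool (w k < x) - x\<bar>)"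
    unfolding local_discrepancy_eq_sum by (rule sum_abs)
  also have "\<dots> \<le> (\<Sum>k=1..n. 1)"
    using assms by (intro sum_mono) auto
  finally show ?thesis by simp
qed

lemma abs_normalized_count_diff:
  assumes "n \<noteq> 0"
  shows "\<bar>real (count_below w n x) / real n - x\<bar> = \<bar>local_discrepancy w n x\<bar> / real n"
proof -
  have "real (count_below w n x) / real n - x = local_discrepancy w n x / real n"
    using assms by (simp add: local_discrepancy_def diff_divide_distrib)
  then show ?thesis by simp
qed

lemma star_discrepancy_le_1: "star_discrepancy w n \<le> 1"
proof -
  have "\<bar>real (count_below w n x) / real n - x\<bar> \<le> 1" if "x \<in> {0..1}" for x
    using that abs_local_discrepancy_le[OF that, of w n]
    by (cases "n = 0") (auto simp: abs_normalized_count_diff)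
  then show ?thesis
    unfolding star_discrepancy_def by (intro cSUP_least) auto
qed

lemma abs_local_discrepancy_le_star_discrepancy:
  assumes "x \<in> {0..1}"
  shows "\<bar>local_discrepancy w n x\<bar> \<le> real n * star_discrepancy w n"
proof (cases "n = 0")
  case False
  have "\<bar>local_discrepancy w n x\<bar> / real n \<le> star_discrepancy w n"
    unfolding star_discrepancy_def abs_normalized_count_diff[OF False, symmetric]
    using abs_local_discrepancy_le[of _ w n] False
    by (intro cSUP_upper assms bdd_aboveI2[where M = 1]) (auto simp: abs_normalized_count_diff)
  then show ?thesis
    using False by (simp add: field_simps)
qed simp

section \<open>Comparing the first and the last quarter of a block\<close>

lemma has_integral_affine_substitution:
  fixes F f :: "real \<Rightarrow> real"
  assumes F: "\<And>y. (F has_real_derivative f y) (at y)" and "a \<le> b" "S \<noteq> 0"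
  shows "((\<lambda>x. f (u - S * (x - a))) has_integral (F u - F (u - S * (b - a))) / S) {a..b}"
proof -
  let ?G = "\<lambda>x. - F (u - S * (x - a)) / S"
  have "(?G has_real_derivative f (u - S * (x - a))) (at x)" for x
  proof -
    have "((\<lambda>x. F (u - S * (x - a))) has_real_derivative f (u - S * (x - a)) * - S) (at x)"
      by (rule DERIV_chain'[OF _ F]) (auto intro!: derivative_eq_intros)
    then show ?thesis
      using \<open>S \<noteq> 0\<close> by (auto intro!: derivative_eq_intros)
  qed
  then have "((\<lambda>x. f (u - S * (x - a))) has_integral (?G b - ?G a)) {a..b}"
    using \<open>a \<le> b\<close> by (intro fundamental_theorem_of_calculus)
      (auto simp flip: has_real_derivative_iff_has_vector_derivative
        intro: has_field_derivative_at_within)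
  then show ?thesis by (simp add: diff_divide_distrib)
qed

locale quartered_block =
  fixes w :: "nat \<Rightarrow> real" and T :: nat
  assumes T_pos: "0 < T"
    and w_unit: "\<And>k. k \<in> {1..4 * T} \<Longrightarrow> w k \<in> {0..1}"
begin

abbreviation first_quarter :: "nat set" where
  "first_quarter \<equiv> {0..T}"

abbreviation last_quarter :: "nat set" where
  "last_quarter \<equiv> {3 * T..4 * T}"

definition lead :: "(nat \<Rightarrow> real) \<Rightarrow> real" where
  "lead h = Max (h ` last_quarter) - Max (h ` first_quarter)"

definition scaled_potential :: "real \<Rightarrow> nat \<Rightarrow> nat \<Rightarrow> real" where
  "scaled_potential y n m = block_potential y (real n / real T) (real m / real T)"

definition energy :: "(nat \<Rightarrow> real) \<Rightarrow> real" where
  "energy h = scaled_potential (lead h) (last_argmax last_quarter h) (last_argmax first_quarter h)"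

definition add_point :: "nat \<Rightarrow> (nat \<Rightarrow> real) \<Rightarrow> nat \<Rightarrow> real" where
  "add_point k h n = h n + of_bool (k \<le> n)"

definition jump_cost :: "nat \<Rightarrow> real" where
  "jump_cost k = (if T < k \<and> k \<le> 3 * T then 1/256 else 1/32)"

definition jumps :: "real \<Rightarrow> real \<Rightarrow> nat set" where
  "jumps a b = {k \<in> {1..4 * T}. a \<le> w k \<and> w k < b}"

abbreviation profile :: "real \<Rightarrow> nat \<Rightarrow> real" where
  "profile x \<equiv> \<lambda>n. local_discrepancy w n x"

abbreviation profile_right :: "real \<Rightarrow> nat \<Rightarrow> real" where
  "profile_right x \<equiv> \<lambda>n. local_discrepancy_right w n x"

definition energy_bound :: "real \<Rightarrow> real \<Rightarrow> bool" where
  "energy_bound a b \<longleftrightarrow> (\<exists>J. ((\<lambda>x. \<bar>lead (profile x)\<bar> - 1/4) has_integral J) {a..b} \<and>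
     energy (profile a) - energy (profile b) \<le> real T * J + sum jump_cost (jumps a b))"

lemma last_quarter_scaled: "n \<in> last_quarter \<Longrightarrow> 3 \<le> real n / real T \<and> real n / real T \<le> 4"
  using T_pos by (auto simp: field_simps simp flip: of_nat_mult of_nat_le_iff)

lemma first_quarter_scaled: "m \<in> first_quarter \<Longrightarrow> 0 \<le> real m / real T \<and> real m / real T \<le> 1"
  using T_pos by (auto simp: field_simps)

lemma jump_cost_nonneg: "0 \<le> jump_cost k"
  by (simp add: jump_cost_def)

lemma scaled_potential_antimono:
  "n' \<le> n \<Longrightarrow> m' \<le> m \<Longrightarrow> scaled_potential y n m \<le> scaled_potential y n' m'"
  unfolding scaled_potential_def
  by (intro block_potential_antimono) (simp_all add: divide_right_mono)

lemma energy_cong: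
  assumes "\<And>n. n \<le> 4 * T \<Longrightarrow> g n = h n"
  shows "energy g = energy h"
proof -
  have "g ` I = h ` I \<and> last_argmax I g = last_argmax I h" if "I \<subseteq> {..4 * T}" for I
  proof -
    have eq: "g n = h n" if "n \<in> I" for n
      using assms that \<open>I \<subseteq> {..4 * T}\<close> by auto
    then have "argmaxs I g = argmaxs I h" by (rule argmaxs_cong)
    with eq show ?thesis by (auto simp: last_argmax_def)
  qed
  from this[of last_quarter] this[of first_quarter] show ?thesis
    by (simp add: energy_def lead_def subset_iff)
qed

lemma energy_le_first_argmax:
  "energy h \<le> scaled_potential (lead h)
     (first_argmax last_quarter h) (first_argmax first_quarter h)"
  unfolding energy_def by (intro scaled_potential_antimono first_argmax_le_last_argmax) auto

lemma last_quarter_add_point: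
  assumes "k \<le> 3 * T"
  shows "Max (add_point k h ` last_quarter) = Max (h ` last_quarter) + 1"
    and "last_argmax last_quarter (add_point k h) = last_argmax last_quarter h"
proof -
  have shift: "add_point k h n = h n + 1" if "n \<in> last_quarter" for n
    using assms that by (simp add: add_point_def)
  show "Max (add_point k h ` last_quarter) = Max (h ` last_quarter) + 1"
    by (rule Max_image_shift[OF _ _ shift]) simp_all
  show "last_argmax last_quarter (add_point k h) = last_argmax last_quarter h"
    by (rule last_argmax_shift[OF shift])
qed

lemma first_quarter_add_point:
  assumes "T < k"
  shows "Max (add_point k h ` first_quarter) = Max (h ` first_quarter)"
    and "last_argmax first_quarter (add_point k h) = last_argmax first_quarter h"
proof -
  have shift: "add_point k h n = h n + 0" if "n \<in> first_quarter" for n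
    using assms that by (simp add: add_point_def)
  have "Max (add_point k h ` first_quarter) = Max (h ` first_quarter) + 0"
    by (rule Max_image_shift[OF _ _ shift]) simp_all
  then show "Max (add_point k h ` first_quarter) = Max (h ` first_quarter)" by simp
  show "last_argmax first_quarter (add_point k h) = last_argmax first_quarter h"
    by (rule last_argmax_shift[OF shift])
qed

lemma lead_le_lead_add_point: "lead h \<le> lead (add_point k h)"
proof (cases "k \<le> 3 * T")
  case True
  have "Max (add_point k h ` first_quarter) \<le> Max ((\<lambda>n. h n + 1) ` first_quarter)"
    by (intro Max_image_mono) (auto simp: add_point_def)
  also have "\<dots> = Max (h ` first_quarter) + 1"
    by (rule Max_add_commute) auto
  finally show ?thesis
    unfolding lead_def last_quarter_add_point(1)[OF True] by linarith
next
  case False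
  have "Max (h ` last_quarter) \<le> Max (add_point k h ` last_quarter)"
    by (intro Max_image_mono) (auto simp: add_point_def)
  then show ?thesis
    using False unfolding lead_def by (simp add: first_quarter_add_point(1))
qed

lemma energy_add_point: "energy h \<le> jump_cost k + energy (add_point k h)"
proof -
  let ?h = "add_point k h"
  define n m where "n = last_argmax last_quarter h" and "m = last_argmax first_quarter h"
  define n' m' where "n' = last_argmax last_quarter ?h" and "m' = last_argmax first_quarter ?h"
  note argmax_defs = n_def m_def n'_def m'_def
  have "n \<in> last_quarter" "n' \<in> last_quarter" "m \<in> first_quarter" "m' \<in> first_quarter"
    unfolding argmax_defs by (rule last_argmax_in; simp)+
  note scaled = this(1,2)[THEN last_quarter_scaled] this(3,4)[THEN first_quarter_scaled]
  consider "k \<le> T" | "T < k" "k \<le> 3 * T" | "3 * T < k" by linarith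
  then have "scaled_potential (lead h) n m \<le> jump_cost k + scaled_potential (lead ?h) n' m'"
  proof cases
    case 1
    then have "n' = n" by (simp add: argmax_defs last_quarter_add_point)
    then show ?thesis
      using 1 scaled lead_le_lead_add_point unfolding scaled_potential_def jump_cost_def
      by (auto intro!: block_potential_jump_first)
  next
    case 2
    then have "n' = n" "m' = m" "lead ?h = lead h + 1"
      by (simp_all add: argmax_defs lead_def last_quarter_add_point first_quarter_add_point)
    then show ?thesis
      using 2 scaled unfolding scaled_potential_def jump_cost_def
      by (auto intro!: block_potential_unit_jump)
  next
    case 3
    then have "m' = m" by (simp add: argmax_defs first_quarter_add_point)
    then show ?thesis
      using 3 scaled lead_le_lead_add_point unfolding scaled_potential_def jump_cost_def
      by (auto intro!: block_potential_jump_last)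
  qed
  then show ?thesis by (simp add: energy_def argmax_defs)
qed

text \<open>Coinciding points of the sequence are passed one at a time, so they need not be distinct.\<close>

lemma energy_add_points:
  assumes "finite S"
  shows "energy h \<le> sum jump_cost S + energy (\<lambda>n. h n + real (card (S \<inter> {..n})))"
  using assms
proof (induction S rule: finite_induct)
  case (insert k S)
  let ?h = "\<lambda>n. h n + real (card (S \<inter> {..n}))"
  have "energy h \<le> sum jump_cost S + energy ?h"
    by (rule insert.IH)
  also have "energy ?h \<le> jump_cost k + energy (add_point k ?h)"
    by (rule energy_add_point)
  also have "add_point k ?h = (\<lambda>n. h n + real (card (insert k S \<inter> {..n})))"
    using insert.hyps by (auto simp: add_point_def Int_insert_left)
  finally show ?case
    using insert.hyps by (simp add: add_ac)
qed simp

lemma energy_profile_right: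
  "energy (profile x) \<le> sum jump_cost {k \<in> {1..4 * T}. w k = x} + energy (profile_right x)"
proof -
  let ?S = "{k \<in> {1..4 * T}. w k = x}"
  have "?S \<inter> {..n} = {k \<in> {1..n}. w k = x}" if "n \<le> 4 * T" for n
    using that by auto
  then have "energy (\<lambda>n. profile x n + real (card (?S \<inter> {..n}))) = energy (profile_right x)"
    by (intro energy_cong) (simp add: local_discrepancy_right_eq)
  moreover have "energy (profile x)
      \<le> sum jump_cost ?S + energy (\<lambda>n. profile x n + real (card (?S \<inter> {..n})))"
    by (rule energy_add_points) simp
  ultimately show ?thesis by simp
qed

lemma lead_energy_affine:
  assumes eq: "\<And>i. i \<le> 4 * T \<Longrightarrow> g i = h i + c i * t"
    and unique: "argmaxs last_quarter (\<lambda>i. h i + c i * t) = {n}"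
      "argmaxs first_quarter (\<lambda>i. h i + c i * t) = {m}"
    and argmax: "n \<in> argmaxs last_quarter h" "m \<in> argmaxs first_quarter h"
  shows "lead g = lead h + (c n - c m) * t \<and> energy g = scaled_potential (lead g) n m"
proof -
  have "argmaxs I g = argmaxs I (\<lambda>i. h i + c i * t)" if "I \<subseteq> {..4 * T}" for I
    using eq that by (intro argmaxs_cong) auto
  with unique have unique': "argmaxs last_quarter g = {n}" "argmaxs first_quarter g = {m}"
    by (simp_all add: subset_iff)
  have "lead g = g n - g m" "lead h = h n - h m"
    using unique' argmax by (simp_all add: lead_def Max_image_eq_argmax)
  moreover have "g n = h n + c n * t" "g m = h m + c m * t"
    using argmax by (auto simp: eq argmaxs_def)
  ultimately show ?thesis
    using unique' by (simp add: energy_def last_argmax_singleton algebra_simps)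
qed

lemma eventually_profile_left:
  fixes x :: real
  defines "n \<equiv> last_argmax last_quarter (profile x)"
    and "m \<equiv> last_argmax first_quarter (profile x)"
  shows "\<forall>\<^sub>F t in at_right 0.
    lead (profile (x - t)) = lead (profile x) + (real n - real m) * t \<and>
    energy (profile (x - t)) = scaled_potential (lead (profile (x - t))) n m"
proof -
  have "\<forall>\<^sub>F t in at_right 0. argmaxs last_quarter (\<lambda>i. profile x i + real i * t) = {n}"
    "\<forall>\<^sub>F t in at_right 0. argmaxs first_quarter (\<lambda>i. profile x i + real i * t) = {m}"
    unfolding n_def m_def by (rule eventually_argmaxs_increasing_slope; simp)+
  then show ?thesis
    using eventually_local_discrepancy_left[of "4 * T" w x]
  proof eventually_elim
    case (elim t)
    show ?case
      by (rule lead_energy_affine[OF _ elim(1,2)])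
        (use elim(3) in \<open>simp_all add: n_def m_def last_argmax_in_argmaxs\<close>)
  qed
qed

lemma eventually_profile_right:
  fixes x :: real
  defines "n \<equiv> first_argmax last_quarter (profile_right x)"
    and "m \<equiv> first_argmax first_quarter (profile_right x)"
  shows "\<forall>\<^sub>F t in at_right 0.
    lead (profile (x + t)) = lead (profile_right x) - (real n - real m) * t \<and>
    energy (profile (x + t)) = scaled_potential (lead (profile (x + t))) n m"
proof -
  have "\<forall>\<^sub>F t in at_right 0. argmaxs last_quarter (\<lambda>i. profile_right x i + - real i * t) = {n}"
    "\<forall>\<^sub>F t in at_right 0. argmaxs first_quarter (\<lambda>i. profile_right x i + - real i * t) = {m}"
    unfolding n_def m_def by (rule eventually_argmaxs_decreasing_slope; simp)+
  then show ?thesis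
    using eventually_local_discrepancy_right[of "4 * T" w x]
  proof eventually_elim
    case (elim t)
    have "lead (profile (x + t)) = lead (profile_right x) + (- real n - - real m) * t \<and>
        energy (profile (x + t)) = scaled_potential (lead (profile (x + t))) n m"
      by (rule lead_energy_affine[OF _ elim(1,2)])
        (use elim(3) in \<open>simp_all add: n_def m_def first_argmax_in_argmaxs\<close>)
    then show ?case by (simp add: algebra_simps)
  qed
qed

lemma potential_descent:
  assumes n: "n \<in> last_quarter" and m: "m \<in> first_quarter" and "a \<le> b"
    and lead_eq: "\<And>x. a < x \<Longrightarrow> x < b \<Longrightarrow> lead (profile x) = u - (real n - real m) * (x - a)"
  defines "v \<equiv> u - (real n - real m) * (b - a)"
  obtains J where "((\<lambda>x. \<bar>lead (profile x)\<bar> - 1/4) has_integral J) {a..b}"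
    "scaled_potential u n m - scaled_potential v n m \<le> real T * J"
proof
  define S where "S = real n - real m"
  define s where "s = real n / real T - real m / real T"
  have s: "2 \<le> s" "s \<le> 4"
    using last_quarter_scaled[OF n] first_quarter_scaled[OF m] unfolding s_def by linarith+
  have S: "S = s * real T" "0 < S"
    using T_pos s by (auto simp: S_def s_def field_simps)
  let ?J = "(centred_abs_primitive u - centred_abs_primitive v) / S"
  have "((\<lambda>x. \<bar>u - S * (x - a)\<bar> - 1/4) has_integral ?J) {a..b}"
    using has_integral_affine_substitution[OF DERIV_centred_abs_primitive \<open>a \<le> b\<close>, of S u] S(2)
    by (simp add: v_def S_def)
  then show "((\<lambda>x. \<bar>lead (profile x)\<bar> - 1/4) has_integral ?J) {a..b}"
    by (rule has_integral_spike_finite[of "{a, b}", rotated 2]) (auto simp: lead_eq S_def)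
  have "v \<le> u" using \<open>a \<le> b\<close> S(2) by (simp add: v_def S_def)
  then have "s * (descent_potential s u - descent_potential s v)
      \<le> centred_abs_primitive u - centred_abs_primitive v"
    by (rule descent_potential_diff_le[OF s])
  then have "descent_potential s u - descent_potential s v
      \<le> (centred_abs_primitive u - centred_abs_primitive v) / s"
    using s by (simp add: field_simps)
  also have "\<dots> = real T * ?J"
    using T_pos S by simp
  finally show "scaled_potential u n m - scaled_potential v n m \<le> real T * ?J"
    by (simp add: scaled_potential_def block_potential_def s_def)
qed

lemma energy_bound_refl: "energy_bound a a"
proof -
  have "jumps a a = {}" by (auto simp: jumps_def)
  then show ?thesis by (auto simp: energy_bound_def intro!: exI[of _ 0])
qed

lemma energy_bound_trans:
  assumes "energy_bound a b" "energy_bound b c" "a \<le> b" "b \<le> c"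
  shows "energy_bound a c"
proof -
  obtain J K where J: "((\<lambda>x. \<bar>lead (profile x)\<bar> - 1/4) has_integral J) {a..b}"
      "energy (profile a) - energy (profile b) \<le> real T * J + sum jump_cost (jumps a b)"
    and K: "((\<lambda>x. \<bar>lead (profile x)\<bar> - 1/4) has_integral K) {b..c}"
      "energy (profile b) - energy (profile c) \<le> real T * K + sum jump_cost (jumps b c)"
    using assms(1,2) by (auto simp: energy_bound_def)
  have "jumps a c = jumps a b \<union> jumps b c" "jumps a b \<inter> jumps b c = {}"
    using assms(3,4) by (auto simp: jumps_def)
  then have "sum jump_cost (jumps a c) = sum jump_cost (jumps a b) + sum jump_cost (jumps b c)"
    by (simp add: sum.union_disjoint jumps_def)
  moreover have "((\<lambda>x. \<bar>lead (profile x)\<bar> - 1/4) has_integral (J + K)) {a..c}"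
    using has_integral_combine[OF assms(3,4) J(1) K(1)] .
  ultimately show ?thesis
    unfolding energy_bound_def using J(2) K(2)
    by (intro exI[of _ "J + K"]) (auto simp: distrib_left)
qed

lemma energy_bound_left: "\<exists>d>0. \<forall>t. 0 < t \<and> t < d \<longrightarrow> energy_bound (x - t) x"
proof -
  define n m where "n = last_argmax last_quarter (profile x)"
    and "m = last_argmax first_quarter (profile x)"
  have n: "n \<in> last_quarter" and m: "m \<in> first_quarter"
    unfolding n_def m_def by (rule last_argmax_in; simp)+
  obtain d where "d > 0" and near: "\<And>t. 0 < t \<Longrightarrow> t < d \<Longrightarrow>
      lead (profile (x - t)) = lead (profile x) + (real n - real m) * t \<and>
      energy (profile (x - t)) = scaled_potential (lead (profile (x - t))) n m"
    using eventually_profile_left[of x] unfolding n_def m_def eventually_at_right_field by auto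
  have "energy_bound (x - t) x" if t: "0 < t" "t < d" for t
  proof -
    have slope: "lead (profile y) = lead (profile (x - t)) - (real n - real m) * (y - (x - t))"
      if "x - t < y" "y < x" for y
      using near[of "x - y"] near[of t] that t by (simp add: algebra_simps)
    obtain J where J: "((\<lambda>x. \<bar>lead (profile x)\<bar> - 1/4) has_integral J) {x - t..x}"
      "scaled_potential (lead (profile (x - t))) n m
        - scaled_potential (lead (profile (x - t)) - (real n - real m) * (x - (x - t))) n m
        \<le> real T * J"
      by (rule potential_descent[OF n m _ slope]) (use t in auto)
    moreover have "lead (profile (x - t)) - (real n - real m) * (x - (x - t)) = lead (profile x)"
      using near[of t] t by simp
    moreover have "energy (profile x) = scaled_potential (lead (profile x)) n m"
      by (simp add: energy_def n_def m_def)
    moreover have "0 \<le> sum jump_cost (jumps (x - t) x)"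
      by (intro sum_nonneg jump_cost_nonneg)
    ultimately show ?thesis
      using near[of t] t unfolding energy_bound_def by (intro exI[of _ J]) simp
  qed
  then show ?thesis using \<open>d > 0\<close> by blast
qed

lemma energy_bound_right: "\<exists>d>0. \<forall>t. 0 < t \<and> t < d \<longrightarrow> energy_bound x (x + t)"
proof -
  define n m where "n = first_argmax last_quarter (profile_right x)"
    and "m = first_argmax first_quarter (profile_right x)"
  have n: "n \<in> last_quarter" and m: "m \<in> first_quarter"
    unfolding n_def m_def by (rule first_argmax_in; simp)+
  obtain d where "d > 0" and near: "\<And>t. 0 < t \<Longrightarrow> t < d \<Longrightarrow>
      lead (profile (x + t)) = lead (profile_right x) - (real n - real m) * t \<and>
      energy (profile (x + t)) = scaled_potential (lead (profile (x + t))) n m"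
    using eventually_profile_right[of x] unfolding n_def m_def eventually_at_right_field by auto
  have jump: "energy (profile x) \<le> sum jump_cost {k \<in> {1..4 * T}. w k = x}
      + scaled_potential (lead (profile_right x)) n m"
    using energy_profile_right[of x] energy_le_first_argmax[of "profile_right x"]
    by (simp add: n_def m_def)
  have "energy_bound x (x + t)" if t: "0 < t" "t < d" for t
  proof -
    have slope: "lead (profile y) = lead (profile_right x) - (real n - real m) * (y - x)"
      if "x < y" "y < x + t" for y
      using near[of "y - x"] that t by simp
    obtain J where J: "((\<lambda>x. \<bar>lead (profile x)\<bar> - 1/4) has_integral J) {x..x + t}"
      "scaled_potential (lead (profile_right x)) n m
        - scaled_potential (lead (profile_right x) - (real n - real m) * (x + t - x)) n m
        \<le> real T * J"
      by (rule potential_descent[OF n m _ slope]) (use t in auto)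
    have "sum jump_cost {k \<in> {1..4 * T}. w k = x} \<le> sum jump_cost (jumps x (x + t))"
      using t by (intro sum_mono2) (auto simp: jump_cost_nonneg jumps_def)
    then show ?thesis
      unfolding energy_bound_def using J jump near[of t] t by (intro exI[of _ J]) simp
  qed
  then show ?thesis using \<open>d > 0\<close> by blast
qed

lemma energy_bound_interval:
  assumes "a \<le> b"
  shows "energy_bound a b"
  using assms
proof (induction rule: Bolzano)
  case (trans a b c)
  then show ?case by (rule energy_bound_trans)
next
  case (local x)
  obtain d e where "d > 0" and left: "\<And>t. 0 < t \<Longrightarrow> t < d \<Longrightarrow> energy_bound (x - t) x"
    and "e > 0" and right: "\<And>t. 0 < t \<Longrightarrow> t < e \<Longrightarrow> energy_bound x (x + t)"
    using energy_bound_left[of x] energy_bound_right[of x] by blast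
  have "energy_bound a b" if "a \<le> x" "x \<le> b" "b - a < min d e" for a b
  proof (rule energy_bound_trans)
    show "energy_bound a x"
      using left[of "x - a"] that energy_bound_refl by (cases "a = x") auto
    show "energy_bound x b"
      using right[of "b - x"] that energy_bound_refl by (cases "b = x") auto
  qed (use that in auto)
  then show ?case
    using \<open>d > 0\<close> \<open>e > 0\<close> by (intro exI[of _ "min d e"]) auto
qed

lemma sum_jump_cost: "sum jump_cost {1..4 * T} = real T * (9/128)"
proof -
  have "sum jump_cost {1..4 * T}
      = sum jump_cost {1..T} + sum jump_cost {T + 1..3 * T} + sum jump_cost {3 * T + 1..4 * T}"
    using sum.ub_add_nat[of 1 "3 * T" jump_cost T] sum.ub_add_nat[of 1 T jump_cost "2 * T"]
    by (simp add: algebra_simps)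
  also have "\<dots> = (\<Sum>k=1..T. 1/32) + (\<Sum>k=T+1..3*T. 1/256) + (\<Sum>k=3*T+1..4*T. 1/32)"
    by (intro arg_cong2[where f = "(+)"] sum.cong) (auto simp: jump_cost_def)
  finally show ?thesis by simp
qed

lemma sum_jump_cost_unit_interval:
  "sum jump_cost (jumps 0 1) + sum jump_cost {k \<in> {1..4 * T}. w k = 1} = real T * (9/128)"
proof -
  have "{1..4 * T} = jumps 0 1 \<union> {k \<in> {1..4 * T}. w k = 1}"
  proof (intro equalityI subsetI)
    fix k assume "k \<in> {1..4 * T}"
    then show "k \<in> jumps 0 1 \<union> {k \<in> {1..4 * T}. w k = 1}"
      using w_unit[of k] by (auto simp: jumps_def)
  qed (auto simp: jumps_def)
  then have "sum jump_cost {1..4 * T} = sum jump_cost (jumps 0 1 \<union> {k \<in> {1..4 * T}. w k = 1})"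
    by (rule arg_cong)
  also have "\<dots> = sum jump_cost (jumps 0 1) + sum jump_cost {k \<in> {1..4 * T}. w k = 1}"
    by (rule sum.union_disjoint) (auto simp: jumps_def)
  finally show ?thesis by (simp only: sum_jump_cost)
qed

text \<open>
  The reflected sequence \<open>1 - w\<close> may take the value \<open>1\<close>; such points are counted only to the right
  of \<open>1\<close>.
\<close>

lemma energy_profile_0: "energy (profile 0) = energy (profile_right 1)"
proof (rule energy_cong)
  fix n assume "n \<le> 4 * T"
  then have "of_bool (w k < 0) - 0 = (of_bool (w k \<le> 1) - 1 :: real)" if "k \<in> {1..n}" for k
    using w_unit[of k] that by auto
  then show "profile 0 n = profile_right 1 n"
    unfolding local_discrepancy_eq_sum local_discrepancy_right_eq_sum by (intro sum.cong refl)
qed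

lemma integral_abs_lead_ge:
  obtains J where "23/128 \<le> J" "((\<lambda>x. \<bar>lead (profile x)\<bar>) has_integral J) {0..1}"
proof -
  obtain J where J: "((\<lambda>x. \<bar>lead (profile x)\<bar> - 1/4) has_integral J) {0..1}"
    "energy (profile 0) - energy (profile 1) \<le> real T * J + sum jump_cost (jumps 0 1)"
    using energy_bound_interval[of 0 1] by (auto simp: energy_bound_def)
  have "0 \<le> real T * J + real T * (9/128)"
    using J(2) energy_profile_right[of 1] energy_profile_0 sum_jump_cost_unit_interval by linarith
  then have "0 \<le> real T * (J + 9/128)" by (simp add: distrib_left)
  then have "23/128 \<le> J + 1/4" using T_pos by (simp add: zero_le_mult_iff)
  moreover have "((\<lambda>x. \<bar>lead (profile x)\<bar>) has_integral (J + 1/4)) {0..1}"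
    using has_integral_add[OF J(1) has_integral_const_real[of "1/4" 0 1]] by simp
  ultimately show ?thesis using that by blast
qed

end

section \<open>Growth of the discrepancy\<close>

definition max_discrepancy :: "(nat \<Rightarrow> real) \<Rightarrow> nat \<Rightarrow> real \<Rightarrow> real" where
  "max_discrepancy w N x = Max ((\<lambda>n. local_discrepancy w n x) ` {0..N})"

definition mean_max_discrepancy :: "(nat \<Rightarrow> real) \<Rightarrow> nat \<Rightarrow> real" where
  "mean_max_discrepancy w N = integral {0..1} (max_discrepancy w N)"

lemma max_discrepancy_has_integral:
  assumes "\<And>k. k \<in> {1..N} \<Longrightarrow> w k \<in> {0..1}"
  shows "(max_discrepancy w N has_integral mean_max_discrepancy w N) {0..1}"
proof -
  have "max_discrepancy w N absolutely_integrable_on {0..1}"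
    unfolding max_discrepancy_def[abs_def] using assms
    by (intro absolutely_integrable_Max absolutely_integrable_local_discrepancy) auto
  then show ?thesis
    unfolding mean_max_discrepancy_def
    by (intro integrable_integral set_lebesgue_integral_eq_integral(1))
qed

lemma max_discrepancy_nonneg: "0 \<le> max_discrepancy w N x"
proof -
  have "local_discrepancy w 0 x \<le> max_discrepancy w N x"
    unfolding max_discrepancy_def by (intro Max_ge imageI finite_imageI) simp_all
  then show ?thesis by simp
qed

lemma mean_max_discrepancy_nonneg: "0 \<le> mean_max_discrepancy w N"
  unfolding mean_max_discrepancy_def
  by (cases "max_discrepancy w N integrable_on {0..1}")
    (auto simp: not_integrable_integral integral_nonneg max_discrepancy_nonneg)

lemma mean_max_discrepancy_le:
  assumes "\<And>k. k \<in> {1..N} \<Longrightarrow> w k \<in> {0..1}"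
    and "\<And>n x. n \<le> N \<Longrightarrow> x \<in> {0..1} \<Longrightarrow> local_discrepancy w n x \<le> B"
  shows "mean_max_discrepancy w N \<le> B"
proof -
  have "max_discrepancy w N x \<le> B" if "x \<in> {0..1}" for x
    unfolding max_discrepancy_def using assms(2) that by auto
  then show ?thesis
    using has_integral_le[OF max_discrepancy_has_integral[OF assms(1)]
        has_integral_const_real[of B 0 1]] by simp
qed

lemma Max_local_discrepancy_shift:
  "Max ((\<lambda>n. local_discrepancy w n x) ` {K..K + N})
     = max_discrepancy (\<lambda>k. w (K + k)) N x + local_discrepancy w K x"
proof -
  have "(\<lambda>n. local_discrepancy w n x) ` {K..K + N} = (\<lambda>n. local_discrepancy w n x) ` (+) K ` {0..N}"
    by (simp add: add.commute)
  also have "\<dots> = (\<lambda>n. local_discrepancy w (K + n) x) ` {0..N}"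
    by (rule image_image)
  also have "Max \<dots> = max_discrepancy (\<lambda>k. w (K + k)) N x + local_discrepancy w K x"
    unfolding max_discrepancy_def by (rule Max_image_shift) (simp_all add: local_discrepancy_add)
  finally show ?thesis .
qed

context quartered_block
begin

lemma max_discrepancy_quarters_le:
  "max_discrepancy w T x + (max_discrepancy (\<lambda>k. w (3 * T + k)) T x + local_discrepancy w (3 * T) x)
     + \<bar>lead (profile x)\<bar> \<le> 2 * max_discrepancy w (4 * T) x"
proof -
  have last: "Max (profile x ` last_quarter)
      = max_discrepancy (\<lambda>k. w (3 * T + k)) T x + local_discrepancy w (3 * T) x"
    using Max_local_discrepancy_shift[of w x "3 * T" T] by simp
  have first: "Max (profile x ` first_quarter) = max_discrepancy w T x"
    by (simp only: max_discrepancy_def)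
  have "Max (profile x ` first_quarter) \<le> max_discrepancy w (4 * T) x"
    "Max (profile x ` last_quarter) \<le> max_discrepancy w (4 * T) x"
    unfolding max_discrepancy_def by (rule Max_mono; auto)+
  then show ?thesis
    unfolding lead_def first last by linarith
qed

lemma mean_max_discrepancy_quarters_le:
  "mean_max_discrepancy w T + mean_max_discrepancy (\<lambda>k. w (3 * T + k)) T
     + (\<Sum>k=1..3 * T. 1/2 - w k) + 23/128 \<le> 2 * mean_max_discrepancy w (4 * T)"
proof -
  obtain J where J: "23/128 \<le> J" "((\<lambda>x. \<bar>lead (profile x)\<bar>) has_integral J) {0..1}"
    by (rule integral_abs_lead_ge)
  have disc: "(local_discrepancy w (3 * T) has_integral (\<Sum>k=1..3 * T. 1/2 - w k)) {0..1}"
    by (rule local_discrepancy_has_integral, rule w_unit) simp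
  have first: "(max_discrepancy w T has_integral mean_max_discrepancy w T) {0..1}"
    by (rule max_discrepancy_has_integral, rule w_unit) simp
  have last: "(max_discrepancy (\<lambda>k. w (3 * T + k)) T has_integral
      mean_max_discrepancy (\<lambda>k. w (3 * T + k)) T) {0..1}"
    by (rule max_discrepancy_has_integral, rule w_unit) simp
  have block: "(max_discrepancy w (4 * T) has_integral mean_max_discrepancy w (4 * T)) {0..1}"
    by (rule max_discrepancy_has_integral, rule w_unit) simp
  have "mean_max_discrepancy w T + (mean_max_discrepancy (\<lambda>k. w (3 * T + k)) T
      + (\<Sum>k=1..3 * T. 1/2 - w k)) + J \<le> 2 * mean_max_discrepancy w (4 * T)"
    by (rule has_integral_le[OF has_integral_add[OF has_integral_add[OF first
          has_integral_add[OF last disc]] J(2)] has_integral_mult_right[OF block]])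
       (rule max_discrepancy_quarters_le)
  then show ?thesis using J(1) by simp
qed

end

lemma sum_mean_max_discrepancy_reflect_ge:
  assumes "\<And>k. k \<in> {1..4 ^ t} \<Longrightarrow> w k \<in> {0..1}"
  shows "23/128 * real t
    \<le> mean_max_discrepancy w (4 ^ t) + mean_max_discrepancy (\<lambda>k. 1 - w k) (4 ^ t)"
  using assms
proof (induction t arbitrary: w)
  case 0
  show ?case by (simp add: mean_max_discrepancy_nonneg)
next
  case (Suc t)
  define T where "T = (4::nat) ^ t"
  have "0 < T" by (simp add: T_def)
  interpret direct: quartered_block w T
    using Suc.prems \<open>0 < T\<close> by unfold_locales (simp_all add: T_def)
  interpret reflected: quartered_block "\<lambda>k. 1 - w k" T
    using direct.w_unit \<open>0 < T\<close> by unfold_locales auto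
  have "23/128 * real t \<le> mean_max_discrepancy w T + mean_max_discrepancy (\<lambda>k. 1 - w k) T"
    using direct.w_unit unfolding T_def by (intro Suc.IH) auto
  moreover have "23/128 * real t \<le> mean_max_discrepancy (\<lambda>k. w (3 * T + k)) T
      + mean_max_discrepancy (\<lambda>k. 1 - w (3 * T + k)) T"
    using direct.w_unit unfolding T_def by (intro Suc.IH) auto
  moreover have "(\<Sum>k=1..3 * T. 1/2 - w k) + (\<Sum>k=1..3 * T. 1/2 - (1 - w k)) = 0"
    by (simp flip: sum.distrib)
  ultimately show ?case
    using direct.mean_max_discrepancy_quarters_le reflected.mean_max_discrepancy_quarters_le
    by (simp add: T_def algebra_simps)
qed

lemma ex_large_discrepancy:
  assumes "w \<in> unit_seqs"
  shows "\<exists>n\<le>4 ^ t. 23/256 * real t \<le> real n * star_discrepancy w n"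
proof -
  let ?d = "\<lambda>n. real n * star_discrepancy w n"
  define B where "B = Max (?d ` {0..4 ^ t})"
  have bound: "\<bar>local_discrepancy w n x\<bar> \<le> B" if "n \<le> 4 ^ t" "x \<in> {0..1}" for n x
  proof -
    have "\<bar>local_discrepancy w n x\<bar> \<le> ?d n"
      using that by (intro abs_local_discrepancy_le_star_discrepancy)
    also have "\<dots> \<le> B" unfolding B_def using that by (intro Max_ge) auto
    finally show ?thesis .
  qed
  have unit: "w k \<in> {0..1}" if "k \<in> {1..4 ^ t}" for k
    using assms that by (auto simp: unit_seqs_def less_imp_le)
  have "mean_max_discrepancy w (4 ^ t) \<le> B"
    using bound by (intro mean_max_discrepancy_le unit) (auto simp: abs_le_iff)
  moreover have "local_discrepancy (\<lambda>k. 1 - w k) n x \<le> B" if "n \<le> 4 ^ t" "x \<in> {0..1}" for n x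
    using local_discrepancy_reflect_le[of w n x] bound[of n "1 - x"] that by simp
  then have "mean_max_discrepancy (\<lambda>k. 1 - w k) (4 ^ t) \<le> B"
    using unit by (intro mean_max_discrepancy_le) auto
  moreover have "23/128 * real t
      \<le> mean_max_discrepancy w (4 ^ t) + mean_max_discrepancy (\<lambda>k. 1 - w k) (4 ^ t)"
    by (rule sum_mean_max_discrepancy_reflect_ge, rule unit)
  ultimately have "23/256 * real t \<le> B" by linarith
  moreover have "B \<in> ?d ` {0..4 ^ t}"
    unfolding B_def by (intro Max_in) auto
  ultimately show ?thesis by auto
qed

lemma infinite_large_discrepancy:
  assumes "w \<in> unit_seqs"
  shows "infinite {N. 1 \<le> N \<and> 23 / (512 * ln 2) * ln (real N) \<le> real N * star_discrepancy w N}"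
  unfolding infinite_nat_iff_unbounded
proof
  fix M :: nat
  obtain t :: nat where "real M / (23/256) < real t"
    using reals_Archimedean2 by blast
  then have t: "real M < 23/256 * real t" by simp
  obtain n where n: "n \<le> 4 ^ t" "23/256 * real t \<le> real n * star_discrepancy w n"
    using ex_large_discrepancy[OF assms] by blast
  have "real n * star_discrepancy w n \<le> real n"
    using star_discrepancy_le_1[of w n] by (simp add: mult_left_le)
  then have "M < n" using n(2) t by linarith
  have "real n \<le> 4 ^ t"
    using n(1) by (metis of_nat_le_iff of_nat_numeral of_nat_power)
  then have "ln (real n) \<le> ln (4 ^ t)"
    using \<open>M < n\<close> by (subst ln_le_cancel_iff) auto
  also have "\<dots> = real t * (2 * ln 2)"
    using ln_realpow[of 2 2] by (simp add: ln_realpow)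
  finally have "23 / (512 * ln 2) * ln (real n) \<le> 23 / (512 * ln 2) * (real t * (2 * ln 2))"
    by (intro mult_left_mono) auto
  also have "\<dots> = 23/256 * real t" by simp
  finally have "23 / (512 * ln 2) * ln (real n) \<le> real n * star_discrepancy w n"
    using n(2) by linarith
  then show "\<exists>n>M. n \<in> {N. 1 \<le> N \<and> 23 / (512 * ln 2) * ln (real N) \<le> real N * star_discrepancy w N}"
    using \<open>M < n\<close> by (intro exI[of _ n]) auto
qed

lemma le_Limsup_frequently:
  fixes f :: "'a \<Rightarrow> 'b::complete_lattice"
  assumes "\<exists>\<^sub>F x in F. c \<le> f x"
  shows "c \<le> Limsup F f"
  unfolding Limsup_def
proof (rule INF_greatest)
  fix P assume "P \<in> {P. eventually P F}"
  then have "\<exists>\<^sub>F x in F. c \<le> f x \<and> P x"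
    using assms by (intro frequently_eventually_frequently) auto
  then obtain x where "c \<le> f x" "P x" by (auto dest: frequently_ex)
  then show "c \<le> (SUP x\<in>{x. P x}. f x)" by (intro SUP_upper2[of x]) auto
qed

lemma c_star_ge: "ereal (23 / (512 * ln 2)) \<le> c_star"
  unfolding c_star_def
proof (intro INF_greatest le_Limsup_frequently)
  fix w assume "w \<in> unit_seqs"
  show "\<exists>\<^sub>F N in sequentially.
      ereal (23 / (512 * ln 2)) \<le> ereal (real N * star_discrepancy w N / ln (real N))"
    unfolding frequently_sequentially
  proof
    fix M
    obtain N where "max M 1 < N" "23 / (512 * ln 2) * ln (real N) \<le> real N * star_discrepancy w N"
      using infinite_large_discrepancy[OF \<open>w \<in> unit_seqs\<close>]
      unfolding infinite_nat_iff_unbounded by blast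
    moreover have "0 < ln (real N)" using \<open>max M 1 < N\<close> by simp
    ultimately have "23 / (512 * ln 2) \<le> real N * star_discrepancy w N / ln (real N)"
      by (simp only: pos_le_divide_eq)
    then show "\<exists>N\<ge>M.
        ereal (23 / (512 * ln 2)) \<le> ereal (real N * star_discrepancy w N / ln (real N))"
      using \<open>max M 1 < N\<close> by (intro exI[of _ N]) simp
  qed
qed

theorem theorem1:
  shows "c_star \<ge> ereal 0.0646363 \<and>
    (\<forall>w\<in>unit_seqs. infinite {N::nat. N \<ge> 1 \<and>
       real N * star_discrepancy w N \<ge> 0.0646363 * ln (real N)})"
proof (intro conjI ballI)
  have "0.0646363 \<le> (23::real) / (512 * (25/36))" by simp
  also have "\<dots> \<le> 23 / (512 * ln 2)"
    using ln2_le_25_over_36 by (intro divide_left_mono) auto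
  finally have const_le: "0.0646363 \<le> 23 / (512 * ln (2::real))" .
  then have "ereal 0.0646363 \<le> ereal (23 / (512 * ln 2))" by (simp only: ereal_less_eq)
  also note c_star_ge
  finally show "c_star \<ge> ereal 0.0646363" .
  fix w assume "w \<in> unit_seqs"
  have "0.0646363 * ln (real N) \<le> 23 / (512 * ln 2) * ln (real N)" if "1 \<le> N" for N :: nat
    using const_le that by (intro mult_right_mono) auto
  then have "{N. 1 \<le> N \<and> 23 / (512 * ln 2) * ln (real N) \<le> real N * star_discrepancy w N}
      \<subseteq> {N. N \<ge> 1 \<and> real N * star_discrepancy w N \<ge> 0.0646363 * ln (real N)}"
    using order_trans by blast
  then show "infinite {N. N \<ge> 1 \<and> real N * star_discrepancy w N \<ge> 0.0646363 * ln (real N)}"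
    using infinite_large_discrepancy[OF \<open>w \<in> unit_seqs\<close>] by (rule infinite_super)
qed

end
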